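(* Let $G$ be an FD-admissible graph of order $n$ and let $k = 1+\lfloor \log_2 n \rfloor \ge 5$. Then $\gamma^{\mathrm{FD}}(G) = k$ if and only if $G$ is obtained (up to isomorphism) from some graph $G^F(k) = (C \cup (V \setminus C), E)$ by removing up to $2^{k-1}-k$ vertices of $V \setminus C$ if $G^F(k)[C]$ has an isolated vertex, and up to $2^{k-1}-1-k$ vertices of $V \setminus C$ otherwise.
   Context: Graphs are finite, simple and undirected. For a graph $G=(V,E)$ and $v\in V$, $N(v)$ is the open neighborhood and $N[v]=N(v)\cup\{v\}$ the closed neighborhood; $G[C]$ is the subgraph induced by $C$. Open twins are distinct non-adjacent vertices $u,v$ with $N(u)=N(v)$; closed twins are distinct adjacent vertices $u,v$ with $N[u]=N[v]$. A set $C\subseteq V$ is dominating if $N[v]\cap C\neq\emptyset$ for all $v\in V$, and full-separating if $N(u)\cap C\neq N(v)\cap C$ and $N[u]\cap C\neq N[v]\cap C$ for all distinct $u,v\in V$. An FD-code is a set that is both full-separating and dominating. A graph is FD-admissible if it has an FD-code; $\gamma^{\mathrm{FD}}(G)$ is the minimum cardinality of an FD-code of $G$. For $k\ge 4$, $G^F(k)$ denotes any graph with vertex set $V$ and a subset $C\subseteq V$ such that $|C|=k$, the induced subgraph $G^F(k)[C]$ has neither open nor closed twins, and $V\setminus C$ consists of exactly one vertex $v_{C'}$ with $N(v_{C'})\cap C=C'$ for each non-empty subset $C'\subseteq C$ such that there is no vertex $u\in C$ with either $N(u)\cap C=C'$ or $N[u]\cap C=C'$; there is no condition on the edges inside $V\setminus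 C$. *)

theory Defs
  imports Complex_Main "Graph_Theory.Digraph_Isomorphism"
begin

text \<open>
  Finite simple undirected graphs are values satisfying the predicate \<open>graph\<close> of the
  Graph_Theory entry (finite symmetric digraphs without loops and parallel arcs): the undirected
  edge \<open>uv\<close> is the pair of arcs with ends \<open>(u, v)\<close> and \<open>(v, u)\<close>.  For such graphs
  \<open>digraph_iso\<close> is ordinary graph isomorphism.
\<close>

definition open_nbhd :: "('a, 'b) pre_digraph \<Rightarrow> 'a \<Rightarrow> 'a set" where
  "open_nbhd G v = {u \<in> verts G. v \<rightarrow>\<^bsub>G\<^esub> u}"

definition closed_nbhd :: "('a, 'b) pre_digraph \<Rightarrow> 'a \<Rightarrow> 'a set" where
  "closed_nbhd G v = open_nbhd G v \<union> {v}"

definition open_twins :: "('a, 'b) pre_digraph \<Rightarrow> 'a \<Rightarrow> 'a \<Rightarrow> bool" where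
  "open_twins G u v \<longleftrightarrow> u \<in> verts G \<and> v \<in> verts G \<and> u \<noteq> v \<and> \<not> u \<rightarrow>\<^bsub>G\<^esub> v \<and>
     open_nbhd G u = open_nbhd G v"

definition closed_twins :: "('a, 'b) pre_digraph \<Rightarrow> 'a \<Rightarrow> 'a \<Rightarrow> bool" where
  "closed_twins G u v \<longleftrightarrow> u \<in> verts G \<and> v \<in> verts G \<and> u \<noteq> v \<and> u \<rightarrow>\<^bsub>G\<^esub> v \<and>
     closed_nbhd G u = closed_nbhd G v"

definition isolated_vertex :: "('a, 'b) pre_digraph \<Rightarrow> 'a \<Rightarrow> bool" where
  "isolated_vertex G u \<longleftrightarrow> u \<in> verts G \<and> open_nbhd G u = {}"

definition dominating_set :: "('a, 'b) pre_digraph \<Rightarrow> 'a set \<Rightarrow> bool" where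
  "dominating_set G C \<longleftrightarrow> C \<subseteq> verts G \<and> (\<forall>v \<in> verts G. closed_nbhd G v \<inter> C \<noteq> {})"

definition full_separating_set :: "('a, 'b) pre_digraph \<Rightarrow> 'a set \<Rightarrow> bool" where
  "full_separating_set G C \<longleftrightarrow> C \<subseteq> verts G \<and>
     (\<forall>u \<in> verts G. \<forall>v \<in> verts G. u \<noteq> v \<longrightarrow>
        open_nbhd G u \<inter> C \<noteq> open_nbhd G v \<inter> C \<and>
        closed_nbhd G u \<inter> C \<noteq> closed_nbhd G v \<inter> C)"

definition FD_code :: "('a, 'b) pre_digraph \<Rightarrow> 'a set \<Rightarrow> bool" where
  "FD_code G C \<longleftrightarrow> full_separating_set G C \<and> dominating_set G C"

definition FD_admissible :: "('a, 'b) pre_digraph \<Rightarrow> bool" where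
  "FD_admissible G \<longleftrightarrow> (\<exists>C. FD_code G C)"

text \<open>Only meaningful for FD-admissible graphs.\<close>

definition FD_number :: "('a, 'b) pre_digraph \<Rightarrow> nat" where
  "FD_number G = (LEAST m. \<exists>C. FD_code G C \<and> card C = m)"

text \<open>
  \<open>GF k H C\<close>: the graph \<open>H\<close> with distinguished vertex subset \<open>C\<close> is one of the graphs
  \<open>G\<^sup>F(k)\<close>.  The bijection says that the vertices outside \<open>C\<close> are exactly one \<open>v\<close> with
  \<open>N(v) \<inter> C = C'\<close> for each admitted \<open>C'\<close>.
\<close>

definition GF :: "nat \<Rightarrow> ('a, 'b) pre_digraph \<Rightarrow> 'a set \<Rightarrow> bool" where
  "GF k H C \<longleftrightarrow> 4 \<le> k \<and> graph H \<and> C \<subseteq> verts H \<and> card C = k \<and>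
     (\<nexists>u v. open_twins (H \<restriction> C) u v \<or> closed_twins (H \<restriction> C) u v) \<and>
     bij_betw (\<lambda>v. open_nbhd H v \<inter> C) (verts H - C)
       {C'. C' \<subseteq> C \<and> C' \<noteq> {} \<and>
            (\<nexists>u. u \<in> C \<and> (open_nbhd H u \<inter> C = C' \<or> closed_nbhd H u \<inter> C = C'))}"

end

theory Submission
  imports Defs
begin

text \<open>
  An FD-code \<open>C\<close> of size \<open>k\<close> separates the vertices by the traces of their closed neighbourhoods
  on \<open>C\<close>, which are non-empty, so a graph with such a code has fewer than \<open>2\<^sup>k\<close> vertices.  More
  precisely, the \<open>2k\<close> traces \<open>N(u) \<inter> C\<close>, \<open>N[u] \<inter> C\<close> of the vertices \<open>u \<in> C\<close> are pairwise distinct,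
  the empty set is among them iff \<open>G[C]\<close> has an isolated vertex, and the vertices outside \<open>C\<close> have
  pairwise distinct non-empty traces among the remaining sets.  Graphs with an FD-code of size
  \<open>k\<close> are therefore the graphs \<open>G\<^sup>F(k)\<close> with some vertices outside \<open>C\<close> missing, and the bound
  \<open>n \<ge> 2\<^sup>k\<^sup>-\<^sup>1\<close> limits how many are missing.
\<close>

text \<open>This is the index set of the bijection in \<open>GF\<close>. It depends only on the
  traces of vertices of \<open>C\<close>, so graphs that agree on these have the same free
  traces.\<close>

definition free_traces :: "('a, 'b) pre_digraph \<Rightarrow> 'a set \<Rightarrow> 'a set set" where
  "free_traces G C = {C'. C' \<subseteq> C \<and> C' \<noteq> {} \<and>
     (\<nexists>u. u \<in> C \<and> (open_nbhd G u \<inter> C = C' \<or> closed_nbhd G u \<inter> C = C'))}"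

section \<open>Neighbourhoods and twins in induced subgraphs\<close>

lemma arcs_ends_induce_subgraph:
  "arcs_ends (G \<restriction> S) = {(u, v) \<in> arcs_ends G. u \<in> S \<and> v \<in> S}"
  by (auto simp: arcs_ends_conv)

lemma open_nbhd_induce_subgraph:
  assumes "S \<subseteq> verts G" "v \<in> S"
  shows "open_nbhd (G \<restriction> S) v = open_nbhd G v \<inter> S"
  using assms by (auto simp: open_nbhd_def arcs_ends_induce_subgraph)

lemma closed_nbhd_induce_subgraph:
  assumes "S \<subseteq> verts G" "v \<in> S"
  shows "closed_nbhd (G \<restriction> S) v = closed_nbhd G v \<inter> S"
  using assms by (auto simp: closed_nbhd_def open_nbhd_induce_subgraph)

lemma (in graph) open_nbhd_sym:
  assumes "u \<in> verts G" "v \<in> open_nbhd G u"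
  shows "u \<in> open_nbhd G v"
  using assms arcs_ends_symmetric[OF sym_arcs] by (auto simp: open_nbhd_def)

lemma (in graph) open_nbhd_irrefl: "v \<notin> open_nbhd G v"
  using adj_not_same by (auto simp: open_nbhd_def)

text \<open>The adjacency clauses in the two notions of twins are automatic: equal open traces on
  \<open>C\<close> exclude an edge \<open>uv\<close> because there are no loops, and equal closed
  traces force one because \<open>v\<close> lies in its own closed neighbourhood.\<close>

lemma (in graph) twin_free_iff:
  assumes "C \<subseteq> verts G"
  shows "(\<nexists>u v. open_twins (G \<restriction> C) u v \<or> closed_twins (G \<restriction> C) u v) \<longleftrightarrow>
    (\<forall>u \<in> C. \<forall>v \<in> C. u \<noteq> v \<longrightarrow>
       open_nbhd G u \<inter> C \<noteq> open_nbhd G v \<inter> C \<and> closed_nbhd G u \<inter> C \<noteq> closed_nbhd G v \<inter> C)"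
proof -
  have adj: "u \<rightarrow>\<^bsub>G \<restriction> C\<^esub> v \<longleftrightarrow> v \<in> open_nbhd G u" if "u \<in> C" "v \<in> C" for u v
    using that assms by (auto simp: arcs_ends_induce_subgraph open_nbhd_def)
  have "open_twins (G \<restriction> C) u v \<longleftrightarrow> open_nbhd G u \<inter> C = open_nbhd G v \<inter> C"
    if "u \<in> C" "v \<in> C" "u \<noteq> v" for u v
    using that assms open_nbhd_irrefl[of v]
    by (auto simp: open_twins_def adj open_nbhd_induce_subgraph)
  moreover have "closed_twins (G \<restriction> C) u v \<longleftrightarrow> closed_nbhd G u \<inter> C = closed_nbhd G v \<inter> C"
    if "u \<in> C" "v \<in> C" "u \<noteq> v" for u v
    using that assms
    by (auto simp: closed_twins_def adj closed_nbhd_induce_subgraph) (auto simp: closed_nbhd_def)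
  moreover have "(\<exists>u v. open_twins (G \<restriction> C) u v \<or> closed_twins (G \<restriction> C) u v) \<longleftrightarrow>
    (\<exists>u \<in> C. \<exists>v \<in> C. u \<noteq> v \<and> (open_twins (G \<restriction> C) u v \<or> closed_twins (G \<restriction> C) u v))"
    by (auto simp: open_twins_def closed_twins_def)
  ultimately show ?thesis
    by (simp only: cong: conj_cong bex_cong) (auto cong: conj_cong)
qed

section \<open>Counting vertices by their traces\<close>

lemma (in graph) open_trace_neq_closed_trace:
  assumes "C \<subseteq> verts G" "u \<in> C" "v \<in> C"
  shows "open_nbhd G u \<inter> C \<noteq> closed_nbhd G v \<inter> C"
proof
  assume eq: "open_nbhd G u \<inter> C = closed_nbhd G v \<inter> C"
  then have "v \<in> open_nbhd G u"
    using assms by (auto simp: closed_nbhd_def)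
  then have "u \<in> open_nbhd G v"
    using assms open_nbhd_sym by blast
  then have "u \<in> open_nbhd G u"
    using eq assms by (auto simp: closed_nbhd_def)
  then show False
    using open_nbhd_irrefl by blast
qed

text \<open>\<open>Pow C\<close> splits into the free traces and the set consisting of the open and
  closed traces of vertices of \<open>C\<close> together with the empty set. Stating the count as a
  sum avoids truncated subtraction.\<close>

lemma card_free_traces:
  assumes "graph G" "C \<subseteq> verts G"
    and twin_free: "\<nexists>u v. open_twins (G \<restriction> C) u v \<or> closed_twins (G \<restriction> C) u v"
  shows "card (free_traces G C) + 2 * card C + (if \<exists>u. isolated_vertex (G \<restriction> C) u then 0 else 1)
    = 2 ^ card C"
proof -
  interpret graph G by fact
  let ?O = "(\<lambda>u. open_nbhd G u \<inter> C) ` C" and ?N = "(\<lambda>u. closed_nbhd G u \<inter> C) ` C"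
  have fin: "finite C"
    using assms(2) finite_verts finite_subset by blast
  note sep = twin_free[unfolded twin_free_iff[OF assms(2)]]
  have "card ?O = card C" "card ?N = card C"
    using sep by (auto intro!: card_image inj_onI)
  moreover have "?O \<inter> ?N = {}"
    using open_trace_neq_closed_trace[OF assms(2)] by auto
  ultimately have card_ON: "card (?O \<union> ?N) = 2 * card C"
    using fin by (simp add: card_Un_disjoint)
  have "{} \<notin> ?N"
    by (auto simp: closed_nbhd_def)
  moreover have "{} \<in> ?O \<longleftrightarrow> (\<exists>u. isolated_vertex (G \<restriction> C) u)"
    using assms(2) by (auto simp: isolated_vertex_def open_nbhd_induce_subgraph image_iff) metis
  \<comment> \<open>The empty set is never free; it adds to the count unless it is already the open
    trace of an isolated vertex of \<open>G \<restriction> C\<close>.\<close>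
  ultimately have "card (insert {} (?O \<union> ?N)) =
      2 * card C + (if \<exists>u. isolated_vertex (G \<restriction> C) u then 0 else 1)"
    using fin card_ON by (auto simp: card_insert_if)
  moreover have "free_traces G C \<inter> insert {} (?O \<union> ?N) = {}"
      "free_traces G C \<union> insert {} (?O \<union> ?N) = Pow C"
    by (auto simp: free_traces_def)
  moreover have "finite (free_traces G C)"
    using fin by (auto intro: finite_subset[of _ "Pow C"] simp: free_traces_def)
  ultimately show ?thesis
    using fin card_Un_disjoint[of "free_traces G C" "insert {} (?O \<union> ?N)"] card_Pow[of C] by simp
qed

text \<open>The \<open>k\<close> vertices of \<open>C\<close> join one vertex per free trace, which
  lowers the deficit \<open>2 * k\<close> to \<open>k\<close>. Subtracting
  \<open>2 ^ (k - 1)\<close> from this order yields the two removal bounds of the theorem.\<close>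

lemma GF_card_verts:
  assumes "GF k H C"
  shows "card (verts H) + k + (if \<exists>u. isolated_vertex (H \<restriction> C) u then 0 else 1) = 2 ^ k"
proof -
  have H: "graph H" "C \<subseteq> verts H" "card C = k"
    and bij: "bij_betw (\<lambda>v. open_nbhd H v \<inter> C) (verts H - C) (free_traces H C)"
    using assms by (auto simp: GF_def free_traces_def)
  interpret graph H by fact
  have "card (verts H) = card (verts H - C) + k"
    using H finite_verts by (metis card_Diff_subset card_mono finite_subset le_add_diff_inverse2)
  then show ?thesis
    using card_free_traces[OF H(1,2)] assms bij_betw_same_card[OF bij] H(3) by (simp add: GF_def)
qed

text \<open>Domination speaks of closed neighbourhoods, so it is the closed traces that are both
  distinct and non-empty. This is the source of the lower bound on \<open>FD_number\<close>.\<close>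

lemma card_verts_less_if_FD_code:
  assumes "finite (verts G)" "FD_code G C"
  shows "card (verts G) < 2 ^ card C"
proof -
  have fin: "finite C"
    using assms by (auto simp: FD_code_def dominating_set_def intro: finite_subset)
  have "inj_on (\<lambda>v. closed_nbhd G v \<inter> C) (verts G)"
    using assms by (auto simp: FD_code_def full_separating_set_def inj_on_def)
  moreover have "(\<lambda>v. closed_nbhd G v \<inter> C) ` verts G \<subseteq> Pow C - {{}}"
    using assms by (auto simp: FD_code_def dominating_set_def)
  ultimately have "card (verts G) \<le> card (Pow C - {{}})"
    using fin by (intro card_inj_on_le) auto
  also have "\<dots> < 2 ^ card C"
    using fin by (simp add: card_Pow)
  finally show ?thesis .
qed

section \<open>Transport of FD-codes along isomorphisms\<close>

lemma FD_code_app_iso: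
  assumes f: "pre_digraph.digraph_isomorphism G f" and code: "FD_code G C"
  shows "FD_code (app_iso f G) (iso_verts f ` C)"
proof -
  let ?f = "iso_verts f"
  have wf: "wf_digraph G" and inj: "inj_on ?f (verts G)"
    using f by (auto simp: pre_digraph.digraph_isomorphism_def)
  have C: "C \<subseteq> verts G"
    using code by (auto simp: FD_code_def dominating_set_def)
  have "open_nbhd (app_iso f G) (?f v) = ?f ` open_nbhd G v" if "v \<in> verts G" for v
    using that inj wf_digraph.adj_in_verts[OF wf]
    by (auto simp: open_nbhd_def wf_digraph.arcs_ends_app_iso_eq[OF wf f] inj_on_eq_iff)
  then have open_tr: "open_nbhd (app_iso f G) (?f v) \<inter> ?f ` C = ?f ` (open_nbhd G v \<inter> C)"
    and closed_tr: "closed_nbhd (app_iso f G) (?f v) \<inter> ?f ` C = ?f ` (closed_nbhd G v \<inter> C)"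
    if "v \<in> verts G" for v
    using that C inj_on_image_Int[OF inj, of "open_nbhd G v" C]
      inj_on_image_Int[OF inj, of "closed_nbhd G v" C]
    by (auto simp: closed_nbhd_def open_nbhd_def)
  \<comment> \<open>Intersecting with \<open>C\<close> keeps both sets inside
    \<open>verts G\<close>, where \<open>?f\<close> is known to be injective.\<close>
  have "?f ` (A \<inter> C) = ?f ` (B \<inter> C) \<longleftrightarrow> A \<inter> C = B \<inter> C" for A B
    using inj C by (intro inj_on_image_eq_iff) auto
  then have "full_separating_set (app_iso f G) (?f ` C)"
    using code C
    by (auto simp: FD_code_def full_separating_set_def open_tr closed_tr)
  moreover have "dominating_set (app_iso f G) (?f ` C)"
    using code C by (auto simp: FD_code_def dominating_set_def closed_tr)
  ultimately show ?thesis
    by (simp add: FD_code_def)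
qed

section \<open>FD-codes and the graphs G^F(k) with vertices removed\<close>

lemma GF_imp_FD_code:
  assumes GF: "GF k H C" and S: "S \<subseteq> verts H - C"
  shows "FD_code (H \<restriction> (verts H - S)) C"
proof -
  have H: "graph H" "C \<subseteq> verts H" "card C = k"
    and bij: "bij_betw (\<lambda>v. open_nbhd H v \<inter> C) (verts H - C) (free_traces H C)"
    using GF by (auto simp: GF_def free_traces_def)
  interpret graph H by fact
  have "\<nexists>u v. open_twins (H \<restriction> C) u v \<or> closed_twins (H \<restriction> C) u v"
    using GF by (simp add: GF_def)
  note sep = this[unfolded twin_free_iff[OF H(2)]]
  let ?K = "H \<restriction> (verts H - S)"
  have C: "C \<subseteq> verts H - S"
    using S H by auto
  \<comment> \<open>Deleting vertices outside \<open>C\<close> changes no trace on \<open>C\<close>,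
    so separation and domination need only be checked in \<open>H\<close>.\<close>
  have tr: "open_nbhd ?K v \<inter> C = open_nbhd H v \<inter> C" "closed_nbhd ?K v \<inter> C = closed_nbhd H v \<inter> C"
    if "v \<in> verts H - S" for v
    using that C by (auto simp: open_nbhd_induce_subgraph closed_nbhd_induce_subgraph)
  have free: "open_nbhd H v \<inter> C \<in> free_traces H C" if "v \<in> verts H" "v \<notin> C" for v
    using bij that by (auto simp: bij_betw_def)
  \<comment> \<open>Since both traces of an outer vertex coincide and \<open>free_traces\<close>
    avoids both kinds of trace from \<open>C\<close>, open and closed separation are settled
    together.\<close>
  have outer: "closed_nbhd H v \<inter> C = open_nbhd H v \<inter> C" if "v \<notin> C" for v
    using that by (auto simp: closed_nbhd_def)
  have "open_nbhd H u \<inter> C \<noteq> open_nbhd H v \<inter> C \<and> closed_nbhd H u \<inter> C \<noteq> closed_nbhd H v \<inter> C"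
    if uv: "u \<in> verts H" "v \<in> verts H" "u \<noteq> v" for u v
  proof -
    consider "u \<in> C" "v \<in> C" | "u \<in> C" "v \<notin> C" | "u \<notin> C" "v \<in> C" | "u \<notin> C" "v \<notin> C" by blast
    then show ?thesis
    proof cases
      case 1
      then show ?thesis using sep uv by blast
    next
      case 2
      then show ?thesis using free[of v] uv outer by (auto simp: free_traces_def)
    next
      case 3
      then show ?thesis using free[of u] uv outer by (auto simp: free_traces_def)
    next
      case 4
      then show ?thesis
        using bij_betw_imp_inj_on[OF bij] uv outer by (auto dest: inj_onD)
    qed
  qed
  moreover have "closed_nbhd H v \<inter> C \<noteq> {}" if "v \<in> verts H" for v
    using free[of v] that outer by (cases "v \<in> C") (auto simp: free_traces_def closed_nbhd_def)
  ultimately show ?thesis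
    using C by (auto simp: FD_code_def full_separating_set_def dominating_set_def tr)
qed

text \<open>For each free trace that no outer vertex of \<open>G\<close> realises, a fresh vertex is
  attached to exactly that subset of \<open>C\<close>; the infinite type supplies the fresh
  vertices. Arcs are vertex pairs, so that deleting the new vertices returns \<open>G\<close> itself
  and not merely a copy.\<close>

lemma FD_code_imp_GF:
  fixes G :: "('a, 'a \<times> 'a) pre_digraph"
  assumes inf: "infinite (UNIV :: 'a set)"
    and G: "graph G" "tail G = fst" "head G = snd"
    and code: "FD_code G C" and k: "card C = k" "4 \<le> k"
  shows "\<exists>(H :: ('a, 'a \<times> 'a) pre_digraph) S.
    GF k H C \<and> S \<subseteq> verts H - C \<and> H \<restriction> (verts H - S) = G"
proof -
  interpret G: graph G by fact
  have C: "C \<subseteq> verts G"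
    using code by (auto simp: FD_code_def dominating_set_def)
  then have finC: "finite C"
    using G.finite_verts finite_subset by blast
  let ?tr = "\<lambda>v. open_nbhd G v \<inter> C"
  define M where "M = free_traces G C - ?tr ` (verts G - C)"
  have "finite (Pow C)"
    using finC by simp
  then have finM: "finite M"
    by (rule rev_finite_subset) (auto simp: M_def free_traces_def)
  have "infinite (- verts G)"
    using inf by (simp add: Compl_eq_Diff_UNIV Diff_infinite_finite)
  then obtain S where S: "finite S" "card S = card M" "S \<subseteq> - verts G"
    using infinite_arbitrarily_large by blast
  then obtain t where t: "bij_betw t S M"
    using finM finite_same_card_bij by blast
  have tC: "t s \<subseteq> C" if "s \<in> S" for s
    using t that by (auto simp: bij_betw_def M_def free_traces_def)
  \<comment> \<open>New vertices are joined only to \<open>C\<close>; edges outside \<open>C\<close>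
    are unconstrained, so none are added there.\<close>
  define E where "E = {(s, c). s \<in> S \<and> c \<in> t s}"
  define H where
    "H = \<lparr>verts = verts G \<union> S, arcs = arcs G \<union> E \<union> E\<inverse>, tail = fst, head = snd\<rparr>"
  have E: "E \<subseteq> S \<times> C"
    using tC by (auto simp: E_def)
  have arcsG: "arcs_ends G = arcs G"
    by (auto simp: arcs_ends_conv G)
  have wfG: "arcs G \<subseteq> verts G \<times> verts G"
    using G.tail_in_verts G.head_in_verts by (force simp: G)
  have arcsH: "arcs_ends H = arcs G \<union> E \<union> E\<inverse>"
    by (auto simp: arcs_ends_conv H_def)
  have vertsH: "verts H = verts G \<union> S"
    by (simp add: H_def)
  have "symmetric H"
    using G.sym_arcs by (auto simp: symmetric_def arcsH arcsG sym_def)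
  moreover have "(v, v) \<notin> E" for v
    using E C S(3) by blast
  moreover have "finite E"
    using E S(1) finC by (meson finite_SigmaI finite_subset)
  ultimately have graphH: "graph H"
    using wfG E C S G.no_loops G
    by unfold_locales (auto simp: H_def arc_to_ends_def)
  have CH: "C \<subseteq> verts H"
    using C by (auto simp: vertsH)
  have old: "open_nbhd H v \<inter> C = ?tr v" if "v \<in> verts G" for v
    using that E C S wfG by (auto simp: open_nbhd_def arcsH arcsG vertsH)
  have new: "open_nbhd H s \<inter> C = t s" if "s \<in> S" for s
    using that E C S wfG tC[OF that]
    by (auto simp: open_nbhd_def arcsH vertsH E_def)
  have old_closed: "closed_nbhd H v \<inter> C = closed_nbhd G v \<inter> C" if "v \<in> verts G" for v
    using old[OF that] by (auto simp: closed_nbhd_def)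
  have sep: "?tr u \<noteq> ?tr v \<and> closed_nbhd G u \<inter> C \<noteq> closed_nbhd G v \<inter> C"
    if "u \<in> verts G" "v \<in> verts G" "u \<noteq> v" for u v
    using code that by (auto simp: FD_code_def full_separating_set_def)
  have "\<nexists>u v. open_twins (H \<restriction> C) u v \<or> closed_twins (H \<restriction> C) u v"
    unfolding graph.twin_free_iff[OF graphH CH] using sep C old old_closed by (metis subsetD)
  moreover have "bij_betw (\<lambda>v. open_nbhd H v \<inter> C) (verts H - C) (free_traces H C)"
  proof -
    have free: "free_traces H C = free_traces G C"
      using old[OF subsetD[OF C]] old_closed[OF subsetD[OF C]]
      by (simp add: free_traces_def cong: conj_cong)
    \<comment> \<open>Domination makes the trace non-empty, and separation from each vertex of
      \<open>C\<close> makes it free.\<close>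
    have "?tr v \<in> free_traces G C" if v: "v \<in> verts G" "v \<notin> C" for v
    proof -
      have cl: "closed_nbhd G v \<inter> C = ?tr v"
        using v by (auto simp: closed_nbhd_def)
      have "?tr v \<noteq> {}"
        using code v cl by (auto simp: FD_code_def dominating_set_def)
      moreover have "?tr u \<noteq> ?tr v \<and> closed_nbhd G u \<inter> C \<noteq> ?tr v" if "u \<in> C" for u
        using sep[of u v] that v C cl by auto
      ultimately show ?thesis
        by (auto simp: free_traces_def)
    qed
    then have "?tr ` (verts G - C) \<union> M = free_traces G C"
      by (auto simp: M_def)
    moreover have "bij_betw (\<lambda>v. open_nbhd H v \<inter> C) (verts G - C) (?tr ` (verts G - C))"
      using sep old by (auto simp: bij_betw_def inj_on_def)
    moreover have "bij_betw (\<lambda>v. open_nbhd H v \<inter> C) S M"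
      using t by (subst bij_betw_cong[OF new])
    moreover have "?tr ` (verts G - C) \<inter> M = {}"
      by (auto simp: M_def)
    moreover have "verts H - C = (verts G - C) \<union> S"
      using S C by (auto simp: vertsH)
    ultimately show ?thesis
      unfolding free by (metis bij_betw_combine)
  qed
  ultimately have "GF k H C"
    using graphH CH k by (simp add: GF_def free_traces_def)
  moreover have "S \<subseteq> verts H - C"
    using S C by (auto simp: vertsH)
  moreover have "verts H - S = verts G"
    using S by (auto simp: vertsH)
  \<comment> \<open>Every added arc has an end in \<open>S\<close>, so restriction discards exactly
    \<open>E\<close> and its converse.\<close>
  moreover have "H \<restriction> verts G = G"
    using wfG E S by (intro pre_digraph.equality) (auto simp: H_def G)
  ultimately show ?thesis by metis
qed

section \<open>Relabelling with vertex pairs as arcs\<close>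

lemma graph_iso_relabel:
  assumes "graph G" and inj: "inj_on f (verts G)"
  obtains h where "pre_digraph.digraph_isomorphism G h" "iso_verts h = f"
    "graph (app_iso h G)" "tail (app_iso h G) = fst" "head (app_iso h G) = snd"
proof -
  interpret graph G by fact
  define h where "h = \<lparr>iso_verts = f, iso_arcs = (\<lambda>a. (f (tail G a), f (head G a))),
    iso_head = snd, iso_tail = fst\<rparr>"
  \<comment> \<open>An arc is determined by its ends because there are no parallel arcs.\<close>
  have "inj_on (\<lambda>a. (f (tail G a), f (head G a))) (arcs G)"
    using inj no_multi_arcs by (auto intro!: inj_onI simp: inj_on_eq_iff arc_to_ends_def)
  then have h: "digraph_isomorphism h"
    using inj wf_digraph_axioms by (simp add: digraph_isomorphism_def h_def)
  interpret H: fin_digraph "app_iso h G"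
    using fin_digraphI_app_iso[OF h] .
  have "symmetric (app_iso h G)"
    unfolding symmetric_def arcs_ends_app_iso_eq[OF h]
    using arcs_ends_symmetric[OF sym_arcs] by (fastforce intro: symI)
  then have "graph (app_iso h G)"
    using no_loops inj
    by unfold_locales (auto simp: h_def arc_to_ends_def inj_on_eq_iff)
  then show thesis
    using h by (intro that[of h]) (auto simp: h_def)
qed

section \<open>The logarithmic bound and the characterisation\<close>

lemma power_le_if_floor_log:
  assumes "int k = 1 + \<lfloor>log 2 (real n)\<rfloor>" "1 < k"
  shows "2 ^ (k - 1) \<le> n"
proof -
  have "real k - 1 \<le> log 2 (real n)"
    using assms by linarith
  \<comment> \<open>By convention \<open>log 2 0\<close> is \<open>0\<close>, which would force
    \<open>k \<le> 1\<close>.\<close>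
  moreover from this have "0 < n"
    using assms(2) by (cases "n = 0") (auto simp: log_def)
  ultimately have "2 powr (real k - 1) \<le> real n"
    by (simp add: le_log_iff)
  then have "real (2 ^ (k - 1)) \<le> real n"
    using assms(2) by (simp add: powr_realpow[symmetric] of_nat_diff)
  then show ?thesis
    by linarith
qed

theorem theorem9:
  fixes G :: "('a, 'b) pre_digraph" and n k :: nat
  assumes "graph G"
    and "FD_admissible G"
    and "n = card (verts G)"
    and "int k = 1 + \<lfloor>log 2 (real n)\<rfloor>"
    and "k \<ge> 5"
  shows "FD_number G = k \<longleftrightarrow>
    (\<exists>(H :: (nat, nat \<times> nat) pre_digraph) C S.
       GF k H C \<and> S \<subseteq> verts H - C \<and>
       card S \<le> (if \<exists>u. isolated_vertex (H \<restriction> C) u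
                 then 2 ^ (k - 1) - k else 2 ^ (k - 1) - 1 - k) \<and>
       digraph_iso G (H \<restriction> (verts H - S)))"
proof
  interpret G: graph G by fact
  have n: "2 ^ (k - 1) \<le> n"
    using power_le_if_floor_log assms by simp
  {
    assume "FD_number G = k"
    moreover have "\<exists>m C. FD_code G C \<and> card C = m"
      using assms by (auto simp: FD_admissible_def)
    then have "\<exists>C. FD_code G C \<and> card C = FD_number G"
      unfolding FD_number_def by (rule LeastI_ex)
    ultimately obtain D where D: "FD_code G D" "card D = k"
      by blast
    \<comment> \<open>The type of \<open>G\<close> may have no room for the missing vertices, so
      \<open>G\<close> is first copied to the natural numbers.\<close>
    obtain f :: "'a \<Rightarrow> nat" where f: "inj_on f (verts G)"
      using finite_imp_inj_to_nat_seg[OF G.finite_verts] by blast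
    obtain h :: "('a, 'b, nat, nat \<times> nat) digraph_isomorphism"
      where h: "pre_digraph.digraph_isomorphism G h" "iso_verts h = f"
      and K: "graph (app_iso h G)" "tail (app_iso h G) = fst" "head (app_iso h G) = snd"
      using graph_iso_relabel[OF assms(1) f] .
    have "D \<subseteq> verts G"
      using D by (auto simp: FD_code_def dominating_set_def)
    then have "card (f ` D) = k"
      using D f by (metis card_image inj_on_subset)
    moreover have "FD_code (app_iso h G) (f ` D)"
      using FD_code_app_iso[OF h(1) D(1)] h(2) by simp
    ultimately obtain H :: "(nat, nat \<times> nat) pre_digraph" and S
      where H: "GF k H (f ` D)" "S \<subseteq> verts H - f ` D" "H \<restriction> (verts H - S) = app_iso h G"
      using FD_code_imp_GF[OF infinite_UNIV_nat K, of "f ` D" k] assms(5) by fastforce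
    have "graph H"
      using H by (simp add: GF_def)
    then interpret H: graph H .
    have "card (verts H - S) = n"
      using arg_cong[OF H(3), of verts] assms(3) f h(2) by (simp add: card_image)
    then have "card (verts H) = n + card S"
      using H(2) H.finite_verts
      by (metis Diff_subset add.commute card_Diff_subset card_mono finite_subset
          le_add_diff_inverse subset_trans)
    \<comment> \<open>Combined with \<open>GF_card_verts\<close> and
      \<open>n \<ge> 2 ^ (k - 1)\<close>, this gives \<open>card S + k\<close>, plus
      \<open>1\<close> without an isolated vertex, at most \<open>2 ^ (k - 1)\<close>; hence the
      subtractions in the bound do not truncate.\<close>
    moreover have "(2::nat) ^ k = 2 * 2 ^ (k - 1)"
      using assms(5) by (simp add: power_eq_if)
    ultimately have "card S \<le> (if \<exists>u. isolated_vertex (H \<restriction> f ` D) u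
        then 2 ^ (k - 1) - k else 2 ^ (k - 1) - 1 - k)"
      using GF_card_verts[OF H(1)] n by (auto split: if_splits)
    moreover have "digraph_iso G (H \<restriction> (verts H - S))"
      using h H by (auto simp: digraph_iso_def)
    ultimately show "\<exists>(H :: (nat, nat \<times> nat) pre_digraph) C S.
       GF k H C \<and> S \<subseteq> verts H - C \<and>
       card S \<le> (if \<exists>u. isolated_vertex (H \<restriction> C) u
                 then 2 ^ (k - 1) - k else 2 ^ (k - 1) - 1 - k) \<and>
       digraph_iso G (H \<restriction> (verts H - S))"
      using H by blast
  next
    assume "\<exists>(H :: (nat, nat \<times> nat) pre_digraph) C S.
       GF k H C \<and> S \<subseteq> verts H - C \<and>
       card S \<le> (if \<exists>u. isolated_vertex (H \<restriction> C) u
                 then 2 ^ (k - 1) - k else 2 ^ (k - 1) - 1 - k) \<and>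
       digraph_iso G (H \<restriction> (verts H - S))"
    then obtain H :: "(nat, nat \<times> nat) pre_digraph" and C S
      where H: "GF k H C" "S \<subseteq> verts H - C" and "digraph_iso G (H \<restriction> (verts H - S))"
      by blast
    \<comment> \<open>The isomorphism is reversed because the known code \<open>C\<close> lives in
      the reduced \<open>H\<close> and has to be carried to \<open>G\<close>.\<close>
    then obtain g where g: "pre_digraph.digraph_isomorphism (H \<restriction> (verts H - S)) g"
      "G = app_iso g (H \<restriction> (verts H - S))"
      using digraph_iso_swap[OF G.wf_digraph_axioms] by (auto simp: digraph_iso_def)
    have code: "FD_code G (iso_verts g ` C)"
      using FD_code_app_iso[OF g(1) GF_imp_FD_code[OF H]] g(2) by simp
    have "C \<subseteq> verts (H \<restriction> (verts H - S))" "card C = k"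
      using H by (auto simp: GF_def)
    then have "card (iso_verts g ` C) = k"
      using g(1) by (metis card_image inj_on_subset pre_digraph.digraph_isomorphism_inj_on_verts)
    \<comment> \<open>A code with fewer than \<open>k\<close> vertices would allow fewer than
      \<open>2 ^ (k - 1)\<close> vertices in \<open>G\<close>.\<close>
    moreover have "k \<le> card C'" if "FD_code G C'" for C'
    proof -
      have "(2::nat) ^ (k - 1) < 2 ^ card C'"
        using card_verts_less_if_FD_code[OF G.finite_verts that] n assms(3) by linarith
      then have "k - 1 < card C'"
        by simp
      then show ?thesis
        by linarith
    qed
    ultimately show "FD_number G = k"
      unfolding FD_number_def using code by (intro Least_equality) auto
  }
qed

end
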